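(* Let $n\in\mathbb{N}$, $n\ge 1$, and let $D_{n+1}=\{d_1,d_2,\ldots,d_t\}$ be the set of all proper divisors of $n+1$ (positive divisors different from $n+1$, including $1$). Then the number $R(n)$ of complete, semi-fast convergent representations of $\{0,1,2,\ldots,n\}$ satisfies $$R(n)=\sum_{i=1}^{t}R(d_i-1),$$ where $R(0)=1$ by convention.
   Context: A finite non-decreasing sequence $(z_j)_{j=1}^{m}$ of positive integers is complete if the set of its subsums $\{\sum_{j\in A}z_j : A\subset\{1,\ldots,m\}\}$ equals $\{0,1,2,\ldots,\sum_{j=1}^{m}z_j\}$; it is then a (complete) representation of the set $\{0,1,\ldots,n\}$ with $n=\sum_{j=1}^m z_j$. It is semi-fast (convergent) if $z_p>\sum_{j:\,z_j<z_p}z_j$ for every $p\in\{1,\ldots,m\}$. $R(n)$ denotes the number of finite non-decreasing sequences of positive integers (of any length) that are complete, semi-fast representations of $\{0,1,\ldots,n\}$; $R(0)=1$. *)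

theory Defs
  imports Main
begin

text \<open>A finite sequence \<open>z\<^sub>1, \<dots>, z\<^sub>m\<close> is a list, indexed from \<open>0\<close> to \<open>m - 1\<close>. Subsums and the
  sums below range over sets of indices, so repeated values are counted with multiplicity.\<close>

definition subsums :: "nat list \<Rightarrow> nat set" where
  "subsums zs = {\<Sum>j\<in>A. zs ! j | A. A \<subseteq> {..<length zs}}"

definition pos_nondecreasing :: "nat list \<Rightarrow> bool" where
  "pos_nondecreasing zs \<longleftrightarrow> sorted zs \<and> (\<forall>z\<in>set zs. 0 < z)"

definition complete_seq :: "nat list \<Rightarrow> bool" where
  "complete_seq zs \<longleftrightarrow> subsums zs = {0..sum_list zs}"

definition semi_fast :: "nat list \<Rightarrow> bool" where
  "semi_fast zs \<longleftrightarrow>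
     (\<forall>p<length zs. (\<Sum>j | j < length zs \<and> zs ! j < zs ! p. zs ! j) < zs ! p)"

definition representations :: "nat \<Rightarrow> nat list set" where
  "representations n =
     {zs. pos_nondecreasing zs \<and> complete_seq zs \<and> semi_fast zs \<and> sum_list zs = n}"

definition R :: "nat \<Rightarrow> nat" where
  "R n = card (representations n)"

text \<open>The sets being counted are finite, so \<open>card\<close> is meaningful.\<close>

lemma finite_representations: "finite (representations n)"
proof (rule finite_subset)
  show "representations n \<subseteq> {zs. set zs \<subseteq> {0..n} \<and> length zs \<le> n}"
  proof (intro subsetI CollectI conjI)
    fix zs z
    assume zs: "zs \<in> representations n"
    then show "z \<in> {0..n}" if "z \<in> set zs"
      using that member_le_sum_list by (auto simp: representations_def)
    have "length zs \<le> sum_list zs" if "\<forall>z\<in>set zs. 0 < z" for zs :: "nat list"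
      using that by (induction zs) auto
    then show "length zs \<le> n"
      using zs by (auto simp: representations_def pos_nondecreasing_def)
  qed
qed (rule finite_lists_length_le, simp)

text \<open>The empty sequence is the only representation of \<open>{0}\<close>, so the convention \<open>R(0) = 1\<close> needs
  no special case.\<close>

lemma R_0: "R 0 = 1"
proof -
  have "representations 0 = {[]}"
  proof (intro equalityI subsetI)
    fix zs assume "zs \<in> representations 0"
    then have "\<forall>z\<in>set zs. 0 < z" and "\<forall>z\<in>set zs. z = 0"
      by (auto simp: representations_def pos_nondecreasing_def)
    then show "zs \<in> {[]}" by (cases zs) auto
  next
    fix zs :: "nat list" assume "zs \<in> {[]}"
    then show "zs \<in> representations 0"
      by (auto simp: representations_def pos_nondecreasing_def complete_seq_def semi_fast_def
          subsums_def)
  qed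
  then show ?thesis by (simp add: R_def)
qed

end

(* Completeness and semi-fast convergence force the largest value d of a representation to be one
   more than the sum of the smaller terms. Deleting the m copies of d leaves a representation of
   {0,...,d-1}, and n + 1 = d * (m + 1), so that d is a proper divisor of n + 1 that determines m.
   Conversely, appending m copies of d to a representation of {0,...,d-1} gives one of
   {0,...,d*(m+1)-1}, by division with remainder. *)
theory Submission
  imports Defs
begin

text \<open>An index set for the concatenation splits at \<open>length xs\<close> into indices of
  \<open>xs\<close> and shifted indices of \<open>ys\<close>, and any two such choices can be glued
  back together.\<close>

lemma subsums_append:
  "subsums (xs @ ys) = {a + b | a b. a \<in> subsums xs \<and> b \<in> subsums ys}"
proof (intro equalityI subsetI)
  fix s assume "s \<in> subsums (xs @ ys)"
  then obtain A where A: "A \<subseteq> {..<length xs + length ys}" and s: "s = (\<Sum>j\<in>A. (xs @ ys) ! j)"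
    by (auto simp: subsums_def)
  \<comment> \<open>\<open>C\<close> is the part of \<open>A\<close> beyond \<open>xs\<close>,
    shifted back so that it indexes \<open>ys\<close>.\<close>
  define B C where "B = A \<inter> {..<length xs}" and "C = {j. length xs + j \<in> A}"
  have C: "C \<subseteq> {..<length ys}" using A by (auto simp: C_def)
  have "A = B \<union> (+) (length xs) ` C"
  proof (intro equalityI subsetI)
    fix j assume j: "j \<in> A"
    show "j \<in> B \<union> (+) (length xs) ` C"
    proof (cases "j < length xs")
      case False
      then have "j = length xs + (j - length xs)" by simp
      then show ?thesis using j unfolding C_def by (metis (mono_tags) UnI2 imageI mem_Collect_eq)
    qed (use j in \<open>simp add: B_def\<close>)
  qed (auto simp: B_def C_def)
  moreover have "finite B" "finite C"
    using C by (auto simp: B_def intro: finite_subset)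
  moreover have "B \<inter> (+) (length xs) ` C = {}" by (auto simp: B_def)
  ultimately have "s = (\<Sum>j\<in>B. (xs @ ys) ! j) + (\<Sum>j\<in>(+) (length xs) ` C. (xs @ ys) ! j)"
    using s by (simp add: sum.union_disjoint)
  also have "(\<Sum>j\<in>B. (xs @ ys) ! j) = (\<Sum>j\<in>B. xs ! j)"
    by (rule sum.cong) (auto simp: B_def nth_append)
  also have "(\<Sum>j\<in>(+) (length xs) ` C. (xs @ ys) ! j) = (\<Sum>j\<in>C. ys ! j)"
    by (simp add: sum.reindex)
  finally show "s \<in> {a + b | a b. a \<in> subsums xs \<and> b \<in> subsums ys}"
    using C unfolding subsums_def B_def by blast
next
  fix s assume "s \<in> {a + b | a b. a \<in> subsums xs \<and> b \<in> subsums ys}"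
  then obtain B C where BC: "B \<subseteq> {..<length xs}" "C \<subseteq> {..<length ys}"
    and s: "s = (\<Sum>j\<in>B. xs ! j) + (\<Sum>j\<in>C. ys ! j)"
    by (auto simp: subsums_def)
  have "(\<Sum>j\<in>B. xs ! j) = (\<Sum>j\<in>B. (xs @ ys) ! j)"
    using BC by (intro sum.cong) (auto simp: nth_append)
  moreover have "(\<Sum>j\<in>C. ys ! j) = (\<Sum>j\<in>(+) (length xs) ` C. (xs @ ys) ! j)"
    by (simp add: sum.reindex)
  moreover have "finite B" "finite C"
    using BC by (auto intro: finite_subset)
  moreover have "B \<inter> (+) (length xs) ` C = {}" using BC by auto
  ultimately have "s = (\<Sum>j\<in>B \<union> (+) (length xs) ` C. (xs @ ys) ! j)"
    using s by (simp add: sum.union_disjoint)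
  moreover have "B \<union> (+) (length xs) ` C \<subseteq> {..<length (xs @ ys)}" using BC by auto
  ultimately show "s \<in> subsums (xs @ ys)" unfolding subsums_def by blast
qed

text \<open>With all entries equal, a subsum depends only on how many indices are chosen; the
  initial segment \<open>{..<k}\<close> realizes each count.\<close>

lemma subsums_replicate: "subsums (replicate m d) = {k * d | k. k \<le> m}"
proof -
  have sum: "(\<Sum>j\<in>A. replicate m d ! j) = card A * d" if "A \<subseteq> {..<m}" for A
  proof -
    have "(\<Sum>j\<in>A. replicate m d ! j) = (\<Sum>j\<in>A. d)"
      using that by (intro sum.cong) auto
    then show ?thesis by simp
  qed
  show ?thesis
  proof (intro equalityI subsetI)
    fix s assume "s \<in> subsums (replicate m d)"
    then obtain A where "A \<subseteq> {..<m}" "s = card A * d"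
      using sum by (auto simp: subsums_def)
    moreover from this have "card A \<le> m"
      using card_mono[of "{..<m}" A] by simp
    ultimately show "s \<in> {k * d | k. k \<le> m}" by blast
  next
    fix s assume "s \<in> {k * d | k. k \<le> m}"
    then obtain k where k: "k \<le> m" "s = k * d" by blast
    then have "{..<k} \<subseteq> {..<m}" by auto
    moreover from sum[OF this] k have "s = (\<Sum>j\<in>{..<k}. replicate m d ! j)" by simp
    ultimately show "s \<in> subsums (replicate m d)"
      unfolding subsums_def length_replicate by blast
  qed
qed

lemma subsums_le_sum_list: "s \<in> subsums zs \<Longrightarrow> s \<le> sum_list zs"
  by (auto simp: subsums_def sum_list_sum_nth atLeast0LessThan intro!: sum_mono2)

text \<open>Trades sums over indices for sums over filtered lists, which simplify directly when
  lists are appended or filtered.\<close>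

lemma semi_fast_iff: "semi_fast zs \<longleftrightarrow> (\<forall>z\<in>set zs. sum_list (filter (\<lambda>x. x < z) zs) < z)"
proof -
  have "(\<Sum>j | j < length zs \<and> zs ! j < z. zs ! j) = sum_list (filter (\<lambda>x. x < z) zs)" for z
  proof -
    have "sum_list (filter (\<lambda>x. x < z) zs) = (\<Sum>x\<leftarrow>zs. if x < z then x else 0)"
      using sum_list_map_filter'[of "\<lambda>x. x" "\<lambda>x. x < z" zs] by simp
    also have "\<dots> = (\<Sum>j\<in>{..<length zs}. if zs ! j < z then zs ! j else 0)"
      by (simp add: sum_list_sum_nth atLeast0LessThan)
    also have "\<dots> = (\<Sum>j | j < length zs \<and> zs ! j < z. zs ! j)"
      using sum.inter_filter[of "{..<length zs}" "\<lambda>j. zs ! j" "\<lambda>j. zs ! j < z"] by simp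
    finally show ?thesis by simp
  qed
  then show ?thesis by (simp add: semi_fast_def all_set_conv_all_nth)
qed

lemma append_replicate_in_representations:
  assumes ys: "ys \<in> representations (d - 1)" and d: "d > 0"
  shows "ys @ replicate m d \<in> representations (d * (m + 1) - 1)"
proof -
  have sum: "sum_list ys = d - 1" and sub: "subsums ys = {0..d - 1}"
    and pos: "sorted ys" "\<forall>z\<in>set ys. 0 < z" and sf: "semi_fast ys"
    using ys by (auto simp: representations_def complete_seq_def pos_nondecreasing_def)
  have less: "z < d" if "z \<in> set ys" for z
    using member_le_sum_list[OF that] sum d by simp
  have sum': "sum_list (ys @ replicate m d) = d * (m + 1) - 1"
    using sum d by (simp add: sum_list_replicate algebra_simps)
  have "pos_nondecreasing (ys @ replicate m d)"
    using pos d less by (auto simp: pos_nondecreasing_def sorted_append less_imp_le)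
  moreover have "semi_fast (ys @ replicate m d)"
    unfolding semi_fast_iff
  proof
    fix z assume "z \<in> set (ys @ replicate m d)"
    then consider "z \<in> set ys" | "z = d" by (auto split: if_splits)
    then show "sum_list (filter (\<lambda>x. x < z) (ys @ replicate m d)) < z"
    proof cases
      case 1
      \<comment> \<open>Every copy of \<open>d\<close> exceeds \<open>z\<close>, so the filter
        leaves only terms of \<open>ys\<close>.\<close>
      then show ?thesis using sf less[OF 1] by (simp add: semi_fast_iff)
    next
      case 2
      \<comment> \<open>The terms below \<open>d\<close> are exactly those of \<open>ys\<close>,
        with sum \<open>d - 1\<close>.\<close>
      then show ?thesis using less sum d by simp
    qed
  qed
  moreover have "complete_seq (ys @ replicate m d)"
    unfolding complete_seq_def
  proof (intro equalityI subsetI)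
    fix s assume "s \<in> {0..sum_list (ys @ replicate m d)}"
    then have "s < d * (m + 1)" using sum' d by auto
    \<comment> \<open>The quotient says how many copies of \<open>d\<close> to take; the remainder
      is at most \<open>d - 1\<close>, hence a subsum of \<open>ys\<close>.\<close>
    then have "s div d < m + 1" by (simp add: less_mult_imp_div_less mult.commute)
    then have "s div d * d \<in> subsums (replicate m d)" unfolding subsums_replicate by auto
    moreover have "s mod d \<in> subsums ys" using sub d by (simp add: less_Suc_eq_le [symmetric])
    moreover have "s = s mod d + s div d * d" by simp
    ultimately show "s \<in> subsums (ys @ replicate m d)" unfolding subsums_append by blast
  qed (simp only: atLeastAtMost_iff le0 subsums_le_sum_list)
  ultimately show ?thesis using sum' by (simp add: representations_def)
qed

text \<open>Take \<open>d\<close> to be the largest entry. The terms below it sum to less than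
  \<open>d\<close> by semi-fast convergence and to at least \<open>d - 1\<close> by completeness,
  which fixes their sum. The hypothesis on \<open>n\<close> ensures that a largest entry
  exists.\<close>

lemma representations_decompose:
  assumes zs: "zs \<in> representations n" and n: "n \<ge> 1"
  obtains ys d m where "d > 0" "m > 0" "n + 1 = d * (m + 1)"
    "ys \<in> representations (d - 1)" "zs = ys @ replicate m d"
proof -
  have sum: "sum_list zs = n" and sub: "subsums zs = {0..n}"
    and pos: "sorted zs" "\<forall>z\<in>set zs. 0 < z" and sf: "semi_fast zs"
    using zs by (auto simp: representations_def complete_seq_def pos_nondecreasing_def)
  have ne: "zs \<noteq> []" using sum n by auto
  define d where "d = last zs"
  define ys where "ys = filter (\<lambda>x. x < d) zs"
  define m where "m = length (filter (\<lambda>x. \<not> x < d) zs)"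
  have d: "d \<in> set zs" "d > 0" using ne pos by (auto simp: d_def)
  have le: "z \<le> d" if "z \<in> set zs" for z
    using that ne \<open>sorted zs\<close> unfolding d_def by (cases zs rule: rev_cases) (auto simp: sorted_append)
  have "filter (\<lambda>x. \<not> x < d) zs = replicate m d"
    unfolding m_def by (rule replicate_eqI) (auto dest: le)
  \<comment> \<open>In a sorted list the entries below \<open>d\<close> form a prefix: after the
    first entry that is at least \<open>d\<close>, all later ones are too.\<close>
  moreover have "zs = filter (\<lambda>x. x < d) zs @ filter (\<lambda>x. \<not> x < d) zs"
    using \<open>sorted zs\<close>
  proof (induction zs)
    case (Cons a zs)
    show ?case
    proof (cases "a < d")
      case False
      then have "filter (\<lambda>x. x < d) zs = []" "filter (\<lambda>x. \<not> x < d) zs = zs"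
        using Cons.prems by (auto simp: filter_empty_conv filter_id_conv)
      then show ?thesis using False by simp
    qed (use Cons in simp)
  qed simp
  ultimately have zs_eq: "zs = ys @ replicate m d" unfolding ys_def by simp
  have m: "m > 0"
    using d(1) by (auto simp: m_def filter_empty_conv)
  have ys_less: "sum_list ys < d"
    using sf d(1) by (simp add: semi_fast_iff ys_def)
  have d_le: "d \<le> n" using member_le_sum_list[OF d(1)] sum by simp
  \<comment> \<open>A subsum smaller than \<open>d\<close> cannot use any copy of \<open>d\<close>,
    so it comes from \<open>ys\<close> alone.\<close>
  have sub_ys: "s \<in> subsums ys" if "s < d" for s
  proof -
    have "s \<in> subsums (ys @ replicate m d)"
      using sub that d_le by (auto simp: zs_eq[symmetric])
    then obtain a k where "a \<in> subsums ys" "s = a + k * d"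
      unfolding subsums_append subsums_replicate by blast
    with that show ?thesis by (cases k) auto
  qed
  \<comment> \<open>The value \<open>d - 1\<close> is itself a subsum of \<open>ys\<close>, which
    bounds the total from below.\<close>
  have sum_ys: "sum_list ys = d - 1"
    using subsums_le_sum_list[OF sub_ys[of "d - 1"]] ys_less d(2) by simp
  have "complete_seq ys"
    unfolding complete_seq_def
    using sub_ys subsums_le_sum_list ys_less by (auto intro: order.strict_trans1)
  moreover have "pos_nondecreasing ys"
    using pos by (auto simp: pos_nondecreasing_def ys_def sorted_filter[of id, simplified])
  moreover have "semi_fast ys"
    unfolding semi_fast_iff
  proof
    fix z assume z: "z \<in> set ys"
    \<comment> \<open>As \<open>z < d\<close>, the deleted copies of \<open>d\<close> never counted
      among the terms below \<open>z\<close>.\<close>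
    then have "filter (\<lambda>x. x < z) ys = filter (\<lambda>x. x < z) zs"
      unfolding ys_def by (auto intro!: filter_cong)
    then show "sum_list (filter (\<lambda>x. x < z) ys) < z"
      using z sf by (simp add: semi_fast_iff ys_def)
  qed
  ultimately have "ys \<in> representations (d - 1)"
    using sum_ys by (simp add: representations_def)
  moreover have "n + 1 = d * (m + 1)"
    using sum sum_ys d(2) by (simp add: zs_eq sum_list_replicate algebra_simps)
  ultimately show thesis using that d(2) m zs_eq by blast
qed

theorem theorem2p10:
  fixes n :: nat
  assumes "n \<ge> 1"
  shows "R n = (\<Sum>d | d dvd n + 1 \<and> d \<noteq> n + 1. R (d - 1))"
proof -
  define D where "D = {d. d dvd n + 1 \<and> d \<noteq> n + 1}"
  \<comment> \<open>The number of copies of \<open>d\<close>, solved from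
    \<open>n + 1 = d * (m d + 1)\<close>.\<close>
  define m where "m d = (n + 1) div d - 1" for d
  define F where "F d = (\<lambda>ys. ys @ replicate (m d) d) ` representations (d - 1)" for d
  have D: "d > 0 \<and> m d > 0 \<and> n + 1 = d * (m d + 1)" if "d \<in> D" for d
  proof -
    from that obtain k where k: "n + 1 = d * k" "d \<noteq> n + 1" by (auto simp: D_def)
    \<comment> \<open>Properness of \<open>d\<close> rules out \<open>k = 1\<close>, so at least one
      copy of \<open>d\<close> is appended.\<close>
    then have "d > 0" "k > 0" "k \<noteq> 1" by (auto intro: gr0I)
    then have "m d = k - 1" using k(1) by (simp add: m_def)
    then show ?thesis using k(1) \<open>d > 0\<close> \<open>k > 0\<close> \<open>k \<noteq> 1\<close> by auto
  qed
  have "representations n = (\<Union>d\<in>D. F d)"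
  proof (intro equalityI subsetI)
    fix zs assume "zs \<in> representations n"
    then obtain ys d k where *: "d > 0" "k > 0" "n + 1 = d * (k + 1)"
      "ys \<in> representations (d - 1)" "zs = ys @ replicate k d"
      using assms by (rule representations_decompose)
    have "d \<in> D" unfolding D_def using * by auto
    moreover have "k = m d" unfolding m_def \<open>n + 1 = d * (k + 1)\<close> using * by simp
    ultimately show "zs \<in> (\<Union>d\<in>D. F d)" using * by (auto simp: F_def)
  next
    fix zs assume "zs \<in> (\<Union>d\<in>D. F d)"
    then obtain d ys where *: "d \<in> D" "ys \<in> representations (d - 1)" "zs = ys @ replicate (m d) d"
      by (auto simp: F_def)
    have "d * (m d + 1) - 1 = n" using D[OF *(1)] by (metis add_diff_cancel_right')
    then show "zs \<in> representations n"
      using append_replicate_in_representations[of ys d "m d"] * D[OF *(1)] by simp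
  qed
  moreover have "finite D"
    unfolding D_def by (rule finite_subset[of _ "{..n + 1}"]) (auto dest: dvd_imp_le)
  moreover have "F d \<inter> F e = {}" if "d \<in> D" "e \<in> D" "d \<noteq> e" for d e
  proof -
    \<comment> \<open>Because \<open>m c > 0\<close>, the divisor can be read off as the last entry,
      so distinct divisors give disjoint families.\<close>
    have "last zs = c" if "zs \<in> F c" "c \<in> D" for zs c
      using that D[OF that(2)] by (auto simp: F_def)
    then show ?thesis using that by blast
  qed
  ultimately have "R n = (\<Sum>d\<in>D. card (F d))"
    unfolding R_def by (simp add: card_UN_disjoint F_def finite_representations)
  also have "\<dots> = (\<Sum>d\<in>D. R (d - 1))"
    \<comment> \<open>For fixed \<open>d\<close> the appended tail is fixed, so appending it is
      injective.\<close>
    unfolding F_def R_def by (intro sum.cong refl card_image) (auto simp: inj_on_def)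
  finally show ?thesis by (simp add: D_def)
qed

end
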